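(* Fix an integer $q\geq 3$. There is a function $\delta(n)\to 0$ as $n\to\infty$ such that for all sufficiently large $n$ there exists a graph $G$ on $n+1$ vertices with $r(G;q) > n^{1+\frac{3q-5}{8q\log q}-\delta(n)}$, together with a vertex $v\in V(G)$ such that $H=G\setminus\{v\}$ satisfies $r(H;q)=n$. In particular, there is $\alpha>0$ depending only on $q$ such that for all sufficiently large $n$ these graphs satisfy $r(G;q)\geq r(H;q)^{1+\alpha}$.
   Context: For an integer $q\geq 2$ and a graph $F$, the $q$-color Ramsey number $r(F;q)$ is the least $N$ such that every coloring of the edges of $K_N$ with $q$ colors contains a monochromatic copy of $F$. Logarithms are to base $2$. *)

theory Defs
  imports Complex_Main
begin

definition simple_graph :: "'a set \<Rightarrow> 'a set set \<Rightarrow> bool" where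
  "simple_graph V E \<longleftrightarrow> finite V \<and> (\<forall>e\<in>E. e \<subseteq> V \<and> card e = 2)"

definition ramsey_arrows :: "nat \<Rightarrow> nat \<Rightarrow> 'a set \<Rightarrow> 'a set set \<Rightarrow> bool" where
  "ramsey_arrows q N V E \<longleftrightarrow>
     (\<forall>c :: nat set \<Rightarrow> nat.
        (\<forall>e. e \<subseteq> {..<N} \<and> card e = 2 \<longrightarrow> c e < q) \<longrightarrow>
        (\<exists>f :: 'a \<Rightarrow> nat. \<exists>i < q. inj_on f V \<and> f ` V \<subseteq> {..<N} \<and>
            (\<forall>e\<in>E. c (f ` e) = i)))"

definition ramsey_num :: "nat \<Rightarrow> 'a set \<Rightarrow> 'a set set \<Rightarrow> nat" where
  "ramsey_num q V E = (LEAST N. ramsey_arrows q N V E)"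

definition del_vertex_edges :: "'a set set \<Rightarrow> 'a \<Rightarrow> 'a set set" where
  "del_vertex_edges E v = {e \<in> E. v \<notin> e}"

end

theory Submission
  imports Defs "HOL-Library.Z2" "HOL-Library.Function_Algebras" "HOL-Library.FuncSet"
begin

text \<open>
  Let \<open>H\<close> be a clique on \<open>k\<close> vertices, where \<open>k\<close> is about \<open>log n / (q log q)\<close>, together with
  \<open>n - k\<close> isolated vertices, and let \<open>G\<close> arise from \<open>H\<close> by joining a new vertex to everything.
  Since \<open>r(K_k; q) \<le> q^(qk) \<le> n\<close>, we have \<open>r(H; q) = n\<close>. The graph \<open>G\<close> contains a clique on
  \<open>k + 1\<close> vertices and is connected with \<open>n + 1\<close> vertices. Take a colouring of a complete graph on
  \<open>M\<close> vertices with \<open>q - 1\<close> colours and without monochromatic clique on \<open>k + 1\<close> vertices, blow each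
  vertex up to a block of \<open>n\<close> vertices, and use the last colour inside the blocks: this contains no
  monochromatic \<open>G\<close>, hence \<open>r(G; q) > n M\<close>.

  For \<open>M\<close> we use the construction of Conlon--Ferber and Wigderson. On the symplectic space of
  dimension \<open>2h\<close> over the field with two elements, join vectors whose product is 1. This graph has
  no clique on \<open>2h + 2\<close> vertices, and only few sequences of vectors are pairwise orthogonal, so each
  of the first \<open>q - 3\<close> colours, pulled back along a suitable map, leaves only a small proportion
  of the \<open>(2h + 2)\<close>-sets without an edge of that colour. The two remaining colours are chosen at
  random.
\<close>

section \<open>Upper bound for multicolour Ramsey numbers of cliques\<close>

definition mono_on_set :: "(nat set \<Rightarrow> nat) \<Rightarrow> nat \<Rightarrow> nat set \<Rightarrow> bool" where
  "mono_on_set c i K \<longleftrightarrow> (\<forall>e. e \<subseteq> K \<and> card e = 2 \<longrightarrow> c e = i)"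

lemma mono_on_set_subset: "mono_on_set c i K \<Longrightarrow> L \<subseteq> K \<Longrightarrow> mono_on_set c i L"
  unfolding mono_on_set_def by blast

text \<open>Separate targets \<open>\<kappa> i\<close> make the induction on their sum possible: a
  large colour class \<open>B i\<close> around a vertex \<open>a\<close> is treated with target
  \<open>i\<close> lowered by one, and a set found in colour \<open>i\<close> is completed by
  \<open>a\<close>.\<close>

lemma ramsey_upper:
  fixes c :: "nat set \<Rightarrow> nat" and q :: nat
  assumes "q \<ge> 2" "finite A" "q ^ (\<Sum>i<q. \<kappa> i) \<le> card A"
    and "\<And>e. e \<subseteq> A \<Longrightarrow> card e = 2 \<Longrightarrow> c e < q"
  shows "\<exists>i<q. \<exists>K\<subseteq>A. card K = \<kappa> i \<and> mono_on_set c i K"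
  using assms(2-)
proof (induction "\<Sum>i<q. \<kappa> i" arbitrary: \<kappa> A rule: less_induct)
  case less
  show ?case
  proof (cases "\<exists>i<q. \<kappa> i = 0")
    case True
    then obtain i where "i < q" "\<kappa> i = 0" by blast
    moreover have "mono_on_set c i {}" unfolding mono_on_set_def by auto
    ultimately show ?thesis by (intro exI[of _ i] conjI exI[of _ "{}"]) auto
  next
    case False
    let ?s = "\<Sum>i<q. \<kappa> i"
    have spos: "?s > 0" using False assms(1) by (intro sum_pos) (auto simp: lessThan_empty_iff)
    have "card A > 0" using less.prems(2) assms(1)
      by (metis gr0I le_zero_eq not_numeral_le_zero power_not_zero)
    then obtain a where a: "a \<in> A" by fastforce
    define B where "B i = {x \<in> A - {a}. c {a, x} = i}" for i
    have finB: "finite (B i)" for i unfolding B_def using less.prems(1) by auto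
    have UB: "A - {a} = (\<Union>i<q. B i)"
    proof -
      have "c {a, x} < q" if "x \<in> A - {a}" for x
        using that a by (intro less.prems(3)) auto
      then show ?thesis unfolding B_def by blast
    qed
    \<comment> \<open>Pigeonhole: if all classes were smaller, \<open>card A - 1\<close> would be at
      most \<open>q ^ ?s - q\<close>, impossible for \<open>q \<ge> 2\<close>.\<close>
    have "\<exists>i<q. q ^ (?s - 1) \<le> card (B i)"
    proof (rule ccontr)
      assume "\<not> ?thesis"
      then have lt: "card (B i) \<le> q ^ (?s - 1) - 1" if "i < q" for i
        using that by fastforce
      have "card A - 1 = card (A - {a})" using a by simp
      also have "\<dots> \<le> (\<Sum>i<q. card (B i))" unfolding UB by (rule card_UN_le) simp
      also have "\<dots> \<le> (\<Sum>i<q. q ^ (?s - 1) - 1)" by (rule sum_mono) (use lt in auto)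
      also have "\<dots> = q * q ^ (?s - 1) - q" by (simp add: diff_mult_distrib2)
      also have "q * q ^ (?s - 1) = q ^ ?s" using spos by (metis power_minus_mult mult.commute)
      finally have "card A - 1 \<le> q ^ ?s - q" .
      moreover have "q \<le> q ^ ?s" using spos assms(1) by (simp add: self_le_power)
      ultimately show False using less.prems(2) assms(1) by linarith
    qed
    then obtain i where i: "i < q" "q ^ (?s - 1) \<le> card (B i)" by blast
    define \<mu> where "\<mu> = \<kappa>(i := \<kappa> i - 1)"
    have \<kappa>i: "\<kappa> i > 0" using False i(1) by auto
    have s1: "?s = \<kappa> i + (\<Sum>j\<in>{..<q} - {i}. \<kappa> j)"
      using i(1) by (intro sum.remove) auto
    have s2: "(\<Sum>j<q. \<mu> j) = \<mu> i + (\<Sum>j\<in>{..<q} - {i}. \<mu> j)"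
      using i(1) by (intro sum.remove) auto
    have "(\<Sum>j\<in>{..<q} - {i}. \<mu> j) = (\<Sum>j\<in>{..<q} - {i}. \<kappa> j)"
      by (rule sum.cong) (auto simp: \<mu>_def)
    then have s3: "(\<Sum>j<q. \<mu> j) = ?s - 1" using s1 s2 \<kappa>i by (simp add: \<mu>_def)
    have "\<exists>j<q. \<exists>K\<subseteq>B i. card K = \<mu> j \<and> mono_on_set c j K"
    proof (rule less.hyps)
      show "(\<Sum>j<q. \<mu> j) < ?s" using s3 spos by simp
      show "q ^ (\<Sum>j<q. \<mu> j) \<le> card (B i)" using s3 i(2) by simp
      show "c e < q" if "e \<subseteq> B i" "card e = 2" for e
        using that less.prems(3) unfolding B_def by auto
    qed (rule finB)
    then obtain j K where jK: "j < q" "K \<subseteq> B i" "card K = \<mu> j" "mono_on_set c j K" by blast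
    show ?thesis
    proof (cases "j = i")
      case False
      then show ?thesis using jK unfolding \<mu>_def B_def
        by (intro exI[of _ j] conjI exI[of _ K]) auto
    next
      case True
      have aK: "a \<notin> K" using jK(2) unfolding B_def by auto
      have "finite K" using jK(2) finB finite_subset by blast
      then have card: "card (insert a K) = \<kappa> i"
        using aK jK(3) True \<kappa>i by (simp add: \<mu>_def)
      have "mono_on_set c i (insert a K)"
        unfolding mono_on_set_def
      proof (intro allI impI, elim conjE)
        fix e assume e: "e \<subseteq> insert a K" "card e = 2"
        show "c e = i"
        proof (cases "a \<in> e")
          case False
          then show ?thesis using e jK(4) True unfolding mono_on_set_def by blast
        next
          case True
          then obtain x where "e = {a, x}" "x \<noteq> a" using e(2) by (auto simp: card_2_iff)
          then show ?thesis using e(1) jK(2) unfolding B_def by auto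
        qed
      qed
      moreover have "insert a K \<subseteq> A" using a jK(2) unfolding B_def by auto
      ultimately show ?thesis using card i(1) by blast
    qed
  qed
qed

section \<open>Isotropic sequences in a symplectic space over the field with two elements\<close>

definition vecs :: "nat \<Rightarrow> (nat \<Rightarrow> bit) set" where
  "vecs h = {x. \<forall>i\<ge>2 * h. x i = 0}"

text \<open>The standard alternating form; in characteristic two its minus sign becomes a
  plus.\<close>

definition sform :: "nat \<Rightarrow> (nat \<Rightarrow> bit) \<Rightarrow> (nat \<Rightarrow> bit) \<Rightarrow> bit" where
  "sform h x y = (\<Sum>i<h. x i * y (h + i) + x (h + i) * y i)"

lemma sform_add_left: "sform h (x + y) z = sform h x z + sform h y z"
  unfolding sform_def sum.distrib[symmetric]
  by (rule sum.cong) (simp_all only: plus_fun_apply distrib_left distrib_right ac_simps)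

lemma sform_commute: "sform h x y = sform h y x"
  unfolding sform_def by (simp only: ac_simps)

lemma sform_add_right: "sform h x (y + z) = sform h x y + sform h x z"
  by (metis sform_add_left sform_commute)

lemma sform_self [simp]: "sform h x x = 0"
  unfolding sform_def by (rule sum.neutral) auto

lemma sform_0 [simp]: "sform h 0 x = 0" "sform h x 0 = 0"
  unfolding sform_def by auto

lemma vec_add_self [simp]: "x + x = (0 :: nat \<Rightarrow> bit)"
  by (auto simp: fun_eq_iff)

lemma vec_add_self_left [simp]: "x + (x + y) = (y :: nat \<Rightarrow> bit)"
  by (simp flip: add.assoc)

lemma vecs_0 [simp]: "0 \<in> vecs h" and vecs_add: "x \<in> vecs h \<Longrightarrow> y \<in> vecs h \<Longrightarrow> x + y \<in> vecs h"
  unfolding vecs_def by auto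

lemma finite_card_vecs: "finite (vecs h) \<and> card (vecs h) = 2 ^ (2 * h)"
proof -
  have "bij_betw (\<lambda>S i. if i \<in> S then 1 else (0 :: bit)) (Pow {..<2 * h}) (vecs h)"
    by (rule bij_betwI[where g = "\<lambda>x. {i. x i = 1}"])
      (auto simp: vecs_def fun_eq_iff linorder_not_less[symmetric] split: if_splits)
  then show ?thesis
    by (metis bij_betw_finite bij_betw_same_card card_Pow card_lessThan finite_Pow_iff
        finite_lessThan)
qed

lemmas finite_vecs [simp] = finite_card_vecs[THEN conjunct1]
lemmas card_vecs = finite_card_vecs[THEN conjunct2]

text \<open>Take the unit vector at the partner of a coordinate \<open>i\<close> where
  \<open>u\<close> is nonzero: \<open>h + i\<close> if \<open>i < h\<close>, and
  \<open>i - h\<close> otherwise.\<close>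

lemma sform_nondegenerate:
  assumes "u \<in> vecs h" "u \<noteq> 0"
  obtains x where "x \<in> vecs h" "sform h x u = 1"
proof -
  obtain i where i: "u i \<noteq> 0" using assms(2) by (auto simp: fun_eq_iff)
  then have i2: "i < 2 * h" using assms(1) unfolding vecs_def by (metis (mono_tags) mem_Collect_eq not_less)
  show thesis
  proof (cases "i < h")
    case True
    let ?x = "\<lambda>j. if j = h + i then 1 else (0 :: bit)"
    have "sform h ?x u = (\<Sum>j<h. if j = i then u i else 0)"
      unfolding sform_def using True by (intro sum.cong) auto
    then have "sform h ?x u = 1" using True i by simp
    then show thesis using that[of ?x] True unfolding vecs_def by auto
  next
    case False
    let ?x = "\<lambda>j. if j = i - h then 1 else (0 :: bit)"
    have "sform h ?x u = (\<Sum>j<h. if j = i - h then u i else 0)"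
      unfolding sform_def using False i2 by (intro sum.cong) auto
    then have "sform h ?x u = 1" using False i i2 by simp
    then show thesis using that[of ?x] False i2 unfolding vecs_def by auto
  qed
qed

definition sgn_bit :: "bit \<Rightarrow> int" where "sgn_bit b = (if b = 0 then 1 else - 1)"

text \<open>Translation by \<open>w\<close> is an involution of \<open>W\<close> that reverses every
  sign, so the sum equals its own negative.\<close>

lemma sum_sgn_bit_eq_0:
  fixes W :: "(nat \<Rightarrow> bit) set"
  assumes "\<And>x. x \<in> W \<Longrightarrow> w + x \<in> W" "\<And>x. x \<in> W \<Longrightarrow> \<phi> (w + x) = \<phi> x + 1"
  shows "(\<Sum>x\<in>W. sgn_bit (\<phi> x)) = 0"
proof -
  have "(\<Sum>x\<in>W. sgn_bit (\<phi> x)) = (\<Sum>x\<in>W. sgn_bit (\<phi> (w + x)))"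
    by (rule sum.reindex_bij_witness[where i = "\<lambda>x. w + x" and j = "\<lambda>x. w + x"])
      (use assms(1) in auto)
  also have "\<dots> = (\<Sum>x\<in>W. - sgn_bit (\<phi> x))"
    by (rule sum.cong) (auto simp: assms(2) sgn_bit_def)
  finally show ?thesis by (simp add: sum_negf)
qed

definition perp :: "nat \<Rightarrow> (nat \<Rightarrow> bit) set \<Rightarrow> (nat \<Rightarrow> bit) set" where
  "perp h U = {x \<in> vecs h. \<forall>u\<in>U. sform h x u = 0}"

text \<open>Closure under addition already gives a subspace, the only scalars being 0 and 1; the
  last conjunct also places \<open>U\<close> inside \<open>vecs h\<close>.\<close>

definition isotropic :: "nat \<Rightarrow> (nat \<Rightarrow> bit) set \<Rightarrow> bool" where
  "isotropic h U \<longleftrightarrow> 0 \<in> U \<and> (\<forall>x\<in>U. \<forall>y\<in>U. x + y \<in> U) \<and> U \<subseteq> perp h U"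

lemma perp_subset: "perp h U \<subseteq> vecs h" unfolding perp_def by auto

lemma finite_perp [simp]: "finite (perp h U)"
  using perp_subset finite_vecs finite_subset by blast

text \<open>Double counting of the sum of the characters \<open>x \<mapsto> (-1)^(x, u)\<close> over all vectors \<open>x\<close> and all \<open>u\<close> in \<open>U\<close>.\<close>

lemma card_mult_card_perp:
  assumes "isotropic h U"
  shows "card U * card (perp h U) = 2 ^ (2 * h)"
proof -
  have U: "0 \<in> U" "\<And>x y. x \<in> U \<Longrightarrow> y \<in> U \<Longrightarrow> x + y \<in> U" "U \<subseteq> vecs h"
    using assms perp_subset unfolding isotropic_def by blast+
  have finU: "finite U" using U(3) finite_subset finite_vecs by blast
  let ?f = "\<lambda>x u. sgn_bit (sform h x u)"
  have 1: "(\<Sum>u\<in>U. ?f x u) = (if x \<in> perp h U then int (card U) else 0)" if x: "x \<in> vecs h" for x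
  proof (cases "x \<in> perp h U")
    case True
    then show ?thesis by (simp add: perp_def sgn_bit_def)
  next
    case False
    then obtain w where "w \<in> U" "sform h x w = 1" using x unfolding perp_def by auto
    then have "(\<Sum>u\<in>U. ?f x u) = 0"
      by (intro sum_sgn_bit_eq_0[of _ w]) (auto simp: U sform_add_right)
    then show ?thesis using False by simp
  qed
  have 2: "(\<Sum>x\<in>vecs h. ?f x u) = (if u = 0 then 2 ^ (2 * h) else 0)" if u: "u \<in> U" for u
  proof (cases "u = 0")
    case True
    then show ?thesis by (simp add: sgn_bit_def card_vecs)
  next
    case False
    then obtain w where "w \<in> vecs h" "sform h w u = 1"
      using sform_nondegenerate[of u h] u U(3) by blast
    then have "(\<Sum>x\<in>vecs h. ?f x u) = 0"
      by (intro sum_sgn_bit_eq_0[of _ w]) (auto simp: vecs_add sform_add_left)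
    then show ?thesis using False by simp
  qed
  have "(\<Sum>x\<in>vecs h. \<Sum>u\<in>U. ?f x u) = (\<Sum>x\<in>vecs h. if x \<in> perp h U then int (card U) else 0)"
    by (rule sum.cong) (auto simp: 1)
  also have "\<dots> = int (card U * card (perp h U))"
    using perp_subset[of h U] by (simp add: sum.If_cases Int_absorb1)
  finally have "int (card U * card (perp h U)) = (\<Sum>u\<in>U. \<Sum>x\<in>vecs h. ?f x u)"
    by (simp add: sum.swap[of _ U])
  also have "\<dots> = (\<Sum>u\<in>U. if u = 0 then 2 ^ (2 * h) else 0)"
    by (rule sum.cong) (auto simp: 2)
  also have "\<dots> = int (2 ^ (2 * h))" using U(1) finU by simp
  finally show ?thesis by (simp only: of_nat_eq_iff)
qed

lemma isotropic_finite: "isotropic h U \<Longrightarrow> finite U"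
  using finite_perp finite_subset unfolding isotropic_def by blast

lemma isotropic_dim_le:
  assumes "isotropic h U" "card U = 2 ^ r"
  shows "r \<le> h"
proof -
  have "card U \<le> card (perp h U)" using assms(1) unfolding isotropic_def by (intro card_mono) auto
  then have "2 ^ r * 2 ^ r \<le> (2 :: nat) ^ (2 * h)"
    using card_mult_card_perp[OF assms(1)] assms(2) by (metis mult_le_mono2)
  then show ?thesis by (simp flip: power_add add: mult_2)
qed

text \<open>The new set is the span of \<open>U\<close> and \<open>y\<close>; as the form is
  alternating, \<open>y\<close> is orthogonal to itself too.\<close>

lemma isotropic_extend:
  assumes "isotropic h U" "y \<in> perp h U"
  shows "isotropic h (U \<union> (+) y ` U)"
proof -
  have U: "0 \<in> U" "\<And>a b. a \<in> U \<Longrightarrow> b \<in> U \<Longrightarrow> a + b \<in> U" "U \<subseteq> vecs h"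
      "\<And>a b. a \<in> U \<Longrightarrow> b \<in> U \<Longrightarrow> sform h a b = 0"
    using assms(1) unfolding isotropic_def perp_def by auto
  have y: "y \<in> vecs h" "\<And>u. u \<in> U \<Longrightarrow> sform h y u = 0" "\<And>u. u \<in> U \<Longrightarrow> sform h u y = 0"
    using assms(2) sform_commute unfolding perp_def by auto
  have add: "a + (y + b) = y + (a + b)" "y + a + b = y + (a + b)" for a b
    by (auto simp: algebra_simps)
  show ?thesis
    unfolding isotropic_def perp_def
    by (auto simp: U y add sform_add_left sform_add_right vecs_add subsetD[OF U(3)])
qed

lemma card_isotropic_extend:
  assumes "isotropic h U" "y \<notin> U"
  shows "card (U \<union> (+) y ` U) = 2 * card U"
proof -
  have "y = (y + u) + u" for u :: "nat \<Rightarrow> bit" by (simp add: add.assoc)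
  then have "y \<in> U" if "y + u \<in> U" "u \<in> U" for u
    using that assms(1) unfolding isotropic_def by metis
  then have "U \<inter> (+) y ` U = {}" using assms(2) by auto
  then show ?thesis
    using isotropic_finite[OF assms(1)] by (simp add: card_Un_disjoint card_image)
qed

text \<open>Lists rather than sets, since the maps into the space used later need not be injective
  and repetitions must be counted. In the induction \<open>U\<close> collects the span of the
  vectors already chosen.\<close>

definition isolists :: "nat \<Rightarrow> nat \<Rightarrow> (nat \<Rightarrow> bit) set \<Rightarrow> (nat \<Rightarrow> bit) list set" where
  "isolists h j U = {ys. length ys = j \<and> set ys \<subseteq> perp h U \<and>
     (\<forall>y\<in>set ys. \<forall>z\<in>set ys. sform h y z = 0)}"

lemma finite_isolists [simp]: "finite (isolists h j U)"
  by (rule finite_subset[OF _ finite_lists_length_eq[OF finite_perp[of h U], of j]])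
    (auto simp: isolists_def)

lemma isolists_Suc_subset:
  "isolists h (Suc j) U \<subseteq> (\<Union>y\<in>perp h U. (#) y ` isolists h j (U \<union> (+) y ` U))"
proof
  fix zs assume zs: "zs \<in> isolists h (Suc j) U"
  then obtain y ys where [simp]: "zs = y # ys" unfolding isolists_def by (cases zs) auto
  have "ys \<in> isolists h j (U \<union> (+) y ` U)"
    using zs unfolding isolists_def perp_def by (auto simp: sform_add_right subset_iff)
  moreover have "y \<in> perp h U" using zs unfolding isolists_def by auto
  ultimately show "zs \<in> (\<Union>y\<in>perp h U. (#) y ` isolists h j (U \<union> (+) y ` U))" by auto
qed

text \<open>
  The exponent \<open>g j r = j h + (h - r) (h - r + 1) / 2\<close> is determined by \<open>g (j + 1) r = (2h - r) + g j (r + 1)\<close>,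
  the case in which the next vector is one of the \<open>2^(2h - r)\<close> orthogonal to \<open>U\<close> but not in \<open>U\<close>;
  the summand \<open>j\<close> pays for the choice between this case and a vector in \<open>U\<close>.
\<close>

lemma card_isolists_le:
  assumes "isotropic h U" "card U = 2 ^ r"
  shows "card (isolists h j U) \<le> 2 ^ (j + j * h + \<Sum>{..h - r})"
  using assms
proof (induction j arbitrary: U r)
  case 0
  have "isolists h 0 U = {[]}" unfolding isolists_def by auto
  then show ?case by simp
next
  case (Suc j)
  let ?P = "perp h U" and ?T = "\<lambda>r. \<Sum>{..h - r}"
  let ?g = "\<lambda>y. isolists h j (U \<union> (+) y ` U)"
  let ?B = "2 ^ (j + j * h + h + ?T r) :: nat"
  have UP: "U \<subseteq> ?P" using Suc.prems unfolding isotropic_def by auto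
  have rh: "r \<le> h" using isotropic_dim_le Suc.prems by blast
  \<comment> \<open>A vector in \<open>U\<close> leaves the subspace unchanged, and there are only
    \<open>2 ^ r\<close>, hence at most \<open>2 ^ h\<close>, of these.\<close>
  have stay: "(\<Sum>y\<in>U. card (?g y)) \<le> ?B"
  proof -
    have "card (?g y) \<le> 2 ^ (j + j * h + ?T r)" if "y \<in> U" for y
    proof -
      have "U \<union> (+) y ` U = U" using Suc.prems(1) that unfolding isotropic_def by auto
      then show ?thesis using Suc.IH[OF Suc.prems] by simp
    qed
    then have "(\<Sum>y\<in>U. card (?g y)) \<le> (\<Sum>y\<in>U. 2 ^ (j + j * h + ?T r))" by (rule sum_mono)
    also have "\<dots> = 2 ^ (r + (j + j * h + ?T r))" using Suc.prems(2) by (simp add: power_add)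
    also have "\<dots> \<le> ?B" using rh by (intro power_increasing) auto
    finally show ?thesis .
  qed
  have grow: "(\<Sum>y\<in>?P - U. card (?g y)) \<le> ?B"
  proof (cases "?P - U = {}")
    case True
    then have "(\<Sum>y\<in>?P - U. card (?g y)) = 0" by (simp only: sum.empty)
    then show ?thesis by simp
  next
    case False
    \<comment> \<open>A vector outside \<open>U\<close> raises the dimension. That one exists forces
      \<open>Suc r \<le> h\<close>, so the subtraction \<open>h - Suc r\<close> is genuine.\<close>
    have ext: "isotropic h (U \<union> (+) y ` U)" "card (U \<union> (+) y ` U) = 2 ^ Suc r"
      if "y \<in> ?P - U" for y
      using that isotropic_extend card_isotropic_extend Suc.prems by auto
    then have r: "Suc r \<le> h" using False isotropic_dim_le by blast
    have "2 ^ r * card ?P = 2 ^ r * 2 ^ (2 * h - r)"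
      using card_mult_card_perp[OF Suc.prems(1)] Suc.prems(2) r by (simp flip: power_add)
    then have "card ?P = 2 ^ (2 * h - r)" by simp
    then have cP: "card (?P - U) \<le> 2 ^ (2 * h - r)" by (metis card_mono finite_perp Diff_subset)
    have T: "?T r = (h - r) + ?T (Suc r)"
      using r by (metis Suc_diff_Suc Suc_le_lessD add.commute sum.atMost_Suc)
    have "(\<Sum>y\<in>?P - U. card (?g y)) \<le> (\<Sum>y\<in>?P - U. 2 ^ (j + j * h + ?T (Suc r)))"
      by (rule sum_mono) (use Suc.IH ext in blast)
    also have "\<dots> \<le> 2 ^ (2 * h - r) * 2 ^ (j + j * h + ?T (Suc r))" using cP by simp
    also have "\<dots> = 2 ^ (2 * h - r + (j + j * h + ?T (Suc r)))" by (simp add: power_add)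
    also have "2 * h - r + (j + j * h + ?T (Suc r)) = j + j * h + h + ?T r" using T r by simp
    finally show ?thesis .
  qed
  have "card (isolists h (Suc j) U) \<le> card (\<Union>y\<in>?P. (#) y ` ?g y)"
    by (rule card_mono[OF _ isolists_Suc_subset]) auto
  also have "\<dots> \<le> (\<Sum>y\<in>?P. card ((#) y ` ?g y))" by (rule card_UN_le) simp
  also have "\<dots> = (\<Sum>y\<in>?P. card (?g y))" by (intro sum.cong card_image) auto
  also have "\<dots> = (\<Sum>y\<in>?P - U. card (?g y)) + (\<Sum>y\<in>U. card (?g y))"
    by (rule sum.subset_diff[OF UP]) simp
  also have "\<dots> \<le> 2 * ?B" using stay grow by linarith
  also have "\<dots> = 2 ^ (Suc j + Suc j * h + ?T r)" by (simp add: algebra_simps)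
  finally show ?case .
qed

text \<open>The sums over subsets of \<open>K\<close> minus one point are pairwise distinct.\<close>

lemma sform_clique_card_le:
  assumes K: "finite K" "K \<subseteq> vecs h" and one: "\<And>x y. x \<in> K \<Longrightarrow> y \<in> K \<Longrightarrow> x \<noteq> y \<Longrightarrow> sform h x y = 1"
  shows "card K \<le> 2 * h + 1"
proof (cases "K = {}")
  case False
  then obtain k where k: "k \<in> K" by blast
  \<comment> \<open>Modulo 2, pairing the sum over \<open>S\<close> with \<open>y\<close> counts the
    members of \<open>S\<close> other than \<open>y\<close>.\<close>
  have val: "sform h (\<Sum>S) y = of_nat (card (S - {y}))" if "S \<subseteq> K" "y \<in> K" for S y
  proof -
    have "finite S" using that K finite_subset by blast
    have "sform h (\<Sum>S) y = (\<Sum>x\<in>S. sform h x y)"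
      using \<open>finite S\<close> by (induction S) (simp_all only: sum.empty sum.insert sform_0 sform_add_left not_False_eq_True)
    also have "\<dots> = (\<Sum>x\<in>S - {y}. sform h x y)"
      by (rule sum.mono_neutral_right) (use \<open>finite S\<close> in auto)
    also have "\<dots> = (\<Sum>x\<in>S - {y}. 1)" using that one by (intro sum.cong) auto
    finally show ?thesis by simp
  qed
  \<comment> \<open>Pairing with \<open>k\<close>, which lies in neither set, shows that
    \<open>S\<close> and \<open>T\<close> have sizes of equal parity; pairing with some
    \<open>y\<close> in \<open>S\<close> but not in \<open>T\<close> would show the
    opposite.\<close>
  have sub: "S \<subseteq> T" if S: "S \<subseteq> K - {k}" and T: "T \<subseteq> K - {k}" and eq: "\<Sum>S = \<Sum>T" for S T
  proof
    fix y assume y: "y \<in> S"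
    show "y \<in> T"
    proof (rule ccontr)
      assume nT: "y \<notin> T"
      have "of_nat (card S) = (of_nat (card T) :: bit)"
        using val[of S k] val[of T k] eq S T k by (simp add: subset_Diff_insert)
      moreover have "of_nat (card (S - {y})) = (of_nat (card T) :: bit)"
        using val[of S y] val[of T y] eq S T y nT by (metis Diff_empty Diff_insert0 Diff_subset subset_iff subset_trans)
      moreover have "card S = Suc (card (S - {y}))"
        using y S K by (metis card.remove finite_Diff finite_subset)
      ultimately show False by (metis add_cancel_right_left of_nat_Suc one_neq_zero)
    qed
  qed
  have "inj_on \<Sum> (Pow (K - {k}))" using sub by (intro inj_onI subset_antisym) auto
  moreover have "\<Sum> ` Pow (K - {k}) \<subseteq> vecs h"
  proof clarify
    fix S assume "S \<subseteq> K - {k}"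
    then have "finite S" "S \<subseteq> vecs h" using K finite_subset by blast+
    then show "\<Sum>S \<in> vecs h" by (induction S) (auto simp: vecs_add)
  qed
  ultimately have "card (Pow (K - {k})) \<le> card (vecs h)" by (rule card_inj_on_le) simp
  then have "(2 :: nat) ^ (card K - 1) \<le> 2 ^ (2 * h)" using k K(1) by (simp add: card_Pow card_vecs)
  then show ?thesis by simp
qed simp

section \<open>Colourings without monochromatic cliques\<close>

text \<open>Averaging over all maps \<open>f\<close> from \<open>A\<close> to the vectors: for each
  fixed \<open>K\<close>, the fraction of maps making \<open>K\<close> pairwise orthogonal is
  controlled by the count of isotropic lists of length \<open>m\<close>.\<close>

lemma exists_map_few_isotropic:
  fixes A :: "nat set"
  assumes A: "finite A" and \<S>: "\<And>K. K \<in> \<S> \<Longrightarrow> K \<subseteq> A \<and> card K = m"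
  shows "\<exists>f. f ` A \<subseteq> vecs h \<and>
    card {K \<in> \<S>. \<forall>x\<in>K. \<forall>y\<in>K. sform h (f x) (f y) = 0} * 2 ^ (2 * h * m)
      \<le> card \<S> * 2 ^ (m + m * h + \<Sum>{..h})"
proof -
  let ?P = "\<lambda>f K. \<forall>x\<in>K. \<forall>y\<in>K. sform h (f x) (f y) = 0"
  let ?F = "A \<rightarrow>\<^sub>E vecs h" and ?I = "2 ^ (m + m * h + \<Sum>{..h}) :: nat"
  let ?V = "2 ^ (2 * h) :: nat"
  have fin\<S>: "finite \<S>" using \<S> A by (intro finite_subset[of \<S> "Pow A"]) auto
  have finF: "finite ?F" using A by (intro finite_PiE) auto
  have iso0: "isotropic h {0}" unfolding isotropic_def perp_def by auto
  have perp0: "perp h {0} = vecs h" unfolding perp_def by auto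
  have one: "card {f \<in> ?F. ?P f K} * ?V ^ m \<le> ?I * card ?F" if K: "K \<in> \<S>" for K
  proof -
    have K2: "K \<subseteq> A" "card K = m" "finite K" using \<S>[OF K] A finite_subset by auto
    obtain xs where xs: "set xs = K" "distinct xs" using finite_distinct_list K2(3) by blast
    \<comment> \<open>A map is determined by its list of values on \<open>K\<close> and its
      restriction to the rest of \<open>A\<close>.\<close>
    let ?\<Phi> = "\<lambda>f. (map f xs, restrict f (A - K))"
    have "inj_on ?\<Phi> {f \<in> ?F. ?P f K}"
    proof (rule inj_onI)
      fix f g assume fg: "f \<in> {f \<in> ?F. ?P f K}" "g \<in> {f \<in> ?F. ?P f K}" "?\<Phi> f = ?\<Phi> g"
      have "f x = g x" if "x \<in> A" for x
      proof (cases "x \<in> K")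
        case True
        then show ?thesis using fg(3) xs(1) by auto
      next
        case False
        then show ?thesis using fg(3) that by (metis Diff_iff Pair_inject restrict_apply)
      qed
      then show "f = g" using fg(1,2) by (intro PiE_ext[of f A _ g]) auto
    qed
    moreover have "?\<Phi> ` {f \<in> ?F. ?P f K} \<subseteq> isolists h m {0} \<times> ((A - K) \<rightarrow>\<^sub>E vecs h)"
      using xs K2 distinct_card[OF xs(2)] unfolding isolists_def perp0 by (auto simp: PiE_iff subset_iff)
    ultimately have "card {f \<in> ?F. ?P f K} \<le> card (isolists h m {0} \<times> ((A - K) \<rightarrow>\<^sub>E vecs h))"
      using A by (intro card_inj_on_le) (auto intro!: finite_PiE)
    also have "\<dots> = card (isolists h m {0}) * ?V ^ (card A - m)"
      using A K2 by (simp add: card_cartesian_product card_funcsetE card_vecs card_Diff_subset)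
    also have "\<dots> \<le> ?I * ?V ^ (card A - m)"
      using card_isolists_le[OF iso0, of 0 m] by simp
    finally have "card {f \<in> ?F. ?P f K} * ?V ^ m \<le> ?I * (?V ^ (card A - m) * ?V ^ m)"
      by simp
    also have "?V ^ (card A - m) * ?V ^ m = card ?F"
      using A K2 card_mono[OF A K2(1)] by (simp add: card_funcsetE card_vecs flip: power_add)
    finally show ?thesis .
  qed
  have swap: "(\<Sum>f\<in>?F. card {K \<in> \<S>. ?P f K}) = (\<Sum>K\<in>\<S>. card {f \<in> ?F. ?P f K})"
    using sum_multicount_gen[OF finF fin\<S>, of "\<lambda>f K. ?P f K" "\<lambda>K. card {f \<in> ?F. ?P f K}"]
    by simp
  have "\<exists>f\<in>?F. card {K \<in> \<S>. ?P f K} * ?V ^ m \<le> card \<S> * ?I"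
  proof (rule ccontr)
    assume "\<not> ?thesis"
    then have gt: "card \<S> * ?I < card {K \<in> \<S>. ?P f K} * ?V ^ m" if "f \<in> ?F" for f
      using that by force
    have "vecs h \<noteq> {}" using vecs_0 by blast
    then have "?F \<noteq> {}" by (simp add: PiE_eq_empty_iff)
    then have "(\<Sum>f\<in>?F. card \<S> * ?I) < (\<Sum>f\<in>?F. card {K \<in> \<S>. ?P f K} * ?V ^ m)"
      using finF gt by (intro sum_strict_mono) auto
    also have "\<dots> = (\<Sum>K\<in>\<S>. card {f \<in> ?F. ?P f K} * ?V ^ m)"
      using swap by (simp flip: sum_distrib_right)
    also have "\<dots> \<le> (\<Sum>K\<in>\<S>. ?I * card ?F)" by (rule sum_mono) (rule one)
    finally show False by (simp add: mult.commute mult.left_commute)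
  qed
  then obtain f where "f \<in> ?F" "card {K \<in> \<S>. ?P f K} * ?V ^ m \<le> card \<S> * ?I" by blast
  then show ?thesis by (intro exI[of _ f]) (auto simp: power_mult)
qed

text \<open>The union bound for a random colouring, carried out by counting.\<close>

lemma two_colouring_avoiding:
  fixes A :: "nat set"
  assumes A: "finite A" and \<S>: "\<And>K. K \<in> \<S> \<Longrightarrow> K \<subseteq> A \<and> card K = m"
    and lt: "2 * card \<S> < 2 ^ (m choose 2)"
  shows "\<exists>c. (\<forall>e. c e < 2) \<and> (\<forall>K\<in>\<S>. \<forall>i<2. \<not> mono_on_set c i K)"
proof -
  define E where "E K = {e. e \<subseteq> K \<and> card e = 2}" for K :: "nat set"
  have fin\<S>: "finite \<S>" using \<S> A by (intro finite_subset[of \<S> "Pow A"]) auto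
  have finE: "finite (E A)" using A unfolding E_def by (intro finite_subset[of "{e. e \<subseteq> A \<and> card e = 2}" "Pow A"]) auto
  \<comment> \<open>A colouring is the edge set \<open>C\<close> of its colour 1. \<open>D K\<close>
    contains those with no edge inside \<open>K\<close>; adjoining \<open>E K\<close> yields those
    with all edges inside \<open>K\<close>.\<close>
  define D where "D K = Pow (E A - E K)" for K
  define bad where "bad K = D K \<union> (\<union>) (E K) ` D K" for K
  have card_bad: "card (bad K) * 2 ^ (m choose 2) \<le> 2 * 2 ^ card (E A)" if "K \<in> \<S>" for K
  proof -
    have K: "K \<subseteq> A" "card K = m" "finite K" using \<S>[OF that] A finite_subset by auto
    have sub: "E K \<subseteq> E A" using K unfolding E_def by auto
    have cE: "card (E K) = m choose 2" using n_subsets[OF K(3)] K(2) unfolding E_def by simp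
    have finD: "finite (D K)" using finE unfolding D_def by simp
    have "card (bad K) \<le> card (D K) + card ((\<union>) (E K) ` D K)" unfolding bad_def by (rule card_Un_le)
    also have "\<dots> \<le> 2 * card (D K)" using card_image_le[OF finD, of "(\<union>) (E K)"] by simp
    also have "card (D K) = 2 ^ (card (E A) - (m choose 2))"
      using finE sub cE unfolding D_def by (simp add: card_Pow card_Diff_subset finite_subset[OF sub])
    finally have "card (bad K) * 2 ^ (m choose 2)
        \<le> 2 * (2 ^ (card (E A) - (m choose 2)) * 2 ^ (m choose 2))" by simp
    also have "2 ^ (card (E A) - (m choose 2)) * 2 ^ (m choose 2) = (2 :: nat) ^ card (E A)"
      using card_mono[OF finE sub] cE by (simp flip: power_add)
    finally show ?thesis .
  qed
  have "card (\<Union>K\<in>\<S>. bad K) * 2 ^ (m choose 2) \<le> (\<Sum>K\<in>\<S>. card (bad K)) * 2 ^ (m choose 2)"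
    using card_UN_le[OF fin\<S>, of bad] by simp
  also have "\<dots> = (\<Sum>K\<in>\<S>. card (bad K) * 2 ^ (m choose 2))" by (rule sum_distrib_right)
  also have "\<dots> \<le> (\<Sum>K\<in>\<S>. 2 * 2 ^ card (E A))" by (rule sum_mono) (rule card_bad)
  also have "\<dots> = 2 * card \<S> * 2 ^ card (E A)" by simp
  also have "\<dots> < 2 ^ (m choose 2) * 2 ^ card (E A)" using lt by simp
  finally have "card (\<Union>K\<in>\<S>. bad K) < card (Pow (E A))" using finE by (simp add: card_Pow)
  moreover have "finite (\<Union>K\<in>\<S>. bad K)" using fin\<S> finE unfolding bad_def D_def by auto
  ultimately have "\<not> Pow (E A) \<subseteq> (\<Union>K\<in>\<S>. bad K)" using card_mono not_le by blast
  then obtain C where C: "C \<subseteq> E A" "\<And>K. K \<in> \<S> \<Longrightarrow> C \<notin> bad K" by blast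
  let ?c = "\<lambda>e. if e \<in> C then 1 else (0 :: nat)"
  have "\<not> mono_on_set ?c i K" if K: "K \<in> \<S>" and i: "i < 2" for K i
  proof
    assume m: "mono_on_set ?c i K"
    have ci: "?c e = i" if "e \<in> E K" for e using m that unfolding mono_on_set_def E_def by blast
    consider "i = 0" | "i = 1" using i by linarith
    then have "C \<in> bad K"
    proof cases
      case 1
      then have "e \<notin> C" if "e \<in> E K" for e using ci[OF that] by (simp split: if_splits)
      then have "C \<in> D K" using C(1) unfolding D_def by blast
      then show ?thesis unfolding bad_def by (rule UnI1)
    next
      case 2
      have "e \<in> C" if "e \<in> E K" for e using ci[OF that] 2 by (metis zero_neq_one)
      then have "E K \<subseteq> C" by blast
      then have "C = E K \<union> (C - E K)" by blast
      moreover have "C - E K \<in> D K" using C(1) unfolding D_def by blast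
      ultimately show ?thesis unfolding bad_def by (metis UnI2 image_eqI)
    qed
    then show False using C(2) K by blast
  qed
  then show ?thesis by (intro exI[of _ ?c]) auto
qed

text \<open>Induction on \<open>j\<close>: a new colour goes to the pairs whose images have product
  1. Only the members of \<open>\<S>\<close> without such a pair still need care, and a suitable map
  shrinks their number by the ratio of the two powers in the assumption. Two random colours finish.
  Arbitrary families \<open>\<S>\<close> are allowed so that the survivors can be passed on.\<close>

lemma colouring_avoiding_family:
  fixes A :: "nat set"
  assumes A: "finite A" and \<S>: "\<And>K. K \<in> \<S> \<Longrightarrow> K \<subseteq> A \<and> card K = 2 * h + 2"
    and lt: "2 * card \<S> * (2 ^ (2 * h + 2 + (2 * h + 2) * h + \<Sum>{..h})) ^ j
      < 2 ^ ((2 * h + 2) choose 2) * (2 ^ (2 * h * (2 * h + 2))) ^ j"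
  shows "\<exists>c. (\<forall>e. c e < j + 2) \<and> (\<forall>K\<in>\<S>. \<forall>i<j + 2. \<not> mono_on_set c i K)"
  using \<S> lt
proof (induction j arbitrary: \<S>)
  case 0
  show ?case
    unfolding add_0 by (rule two_colouring_avoiding[OF A, of \<S> "2 * h + 2"]) (use 0 in simp_all)
next
  case (Suc j)
  let ?m = "2 * h + 2"
  let ?a = "2 ^ (?m + ?m * h + \<Sum>{..h}) :: nat" and ?b = "2 ^ (2 * h * ?m) :: nat"
  obtain f where f: "f ` A \<subseteq> vecs h" and
    le: "card {K \<in> \<S>. \<forall>x\<in>K. \<forall>y\<in>K. sform h (f x) (f y) = 0} * ?b \<le> card \<S> * ?a"
    using exists_map_few_isotropic[OF A, of \<S> ?m h] Suc.prems(1) by blast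
  define \<T> where "\<T> = {K \<in> \<S>. \<forall>x\<in>K. \<forall>y\<in>K. sform h (f x) (f y) = 0}"
  have "2 * card \<T> * ?a ^ j * ?b = 2 * (card \<T> * ?b) * ?a ^ j" by simp
  also have "\<dots> \<le> 2 * (card \<S> * ?a) * ?a ^ j"
    by (rule mult_le_mono1[OF mult_le_mono2[OF le[folded \<T>_def]]])
  also have "\<dots> = 2 * card \<S> * ?a ^ Suc j" by simp
  also have "\<dots> < 2 ^ (?m choose 2) * ?b ^ Suc j" by (rule Suc.prems(2))
  also have "\<dots> = 2 ^ (?m choose 2) * ?b ^ j * ?b" by simp
  finally have "2 * card \<T> * ?a ^ j < 2 ^ (?m choose 2) * ?b ^ j" by (simp only: mult_less_cancel2)
  moreover have "\<And>K. K \<in> \<T> \<Longrightarrow> K \<subseteq> A \<and> card K = ?m" using Suc.prems(1) unfolding \<T>_def by blast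
  ultimately obtain c where c: "\<And>e. c e < j + 2"
    and nc: "\<And>K i. K \<in> \<T> \<Longrightarrow> i < j + 2 \<Longrightarrow> \<not> mono_on_set c i K"
    using Suc.IH[of \<T>] by blast
  \<comment> \<open>The old colours are those below \<open>j + 2\<close>, so \<open>j + 2\<close> is
    the new one.\<close>
  define d where "d e = (if \<exists>x\<in>e. \<exists>y\<in>e. sform h (f x) (f y) = 1 then j + 2 else c e)" for e
  have d2: "d {x, y} = (if sform h (f x) (f y) = 1 then j + 2 else c {x, y})" for x y
    unfolding d_def using sform_commute by auto
  have "\<not> mono_on_set d i K" if K: "K \<in> \<S>" and i: "i < Suc j + 2" for K i
  proof
    assume m: "mono_on_set d i K"
    have K2: "K \<subseteq> A" "card K = ?m" "finite K" using Suc.prems(1)[OF K] A finite_subset by auto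
    have dxy: "d {x, y} = i" if "x \<in> K" "y \<in> K" "x \<noteq> y" for x y
      using m that unfolding mono_on_set_def by (metis card_2_iff empty_subsetI insert_subset)
    show False
    proof (cases "i = j + 2")
      case True
      have one: "sform h (f x) (f y) = 1" if "x \<in> K" "y \<in> K" "x \<noteq> y" for x y
        using dxy[OF that] c[of "{x, y}"] unfolding d2 True by (auto split: if_splits)
      \<comment> \<open>Points with equal images would have product 0. Hence the image is a clique
        of \<open>2 * h + 2\<close> vectors, one too many.\<close>
      have "inj_on f K"
        by (rule inj_onI) (metis one sform_self zero_neq_one)
      then have "card (f ` K) = ?m" using K2(2) by (simp add: card_image)
      moreover have "card (f ` K) \<le> 2 * h + 1"
        using K2 f one by (intro sform_clique_card_le) auto
      ultimately show False by simp
    next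
      case False
      have zero: "sform h (f x) (f y) = 0" if "x \<in> K" "y \<in> K" for x y
      proof (cases "x = y")
        case neq: False
        show ?thesis using dxy[OF that neq] False unfolding d2 by (auto split: if_splits)
      qed simp
      then have "K \<in> \<T>" using K unfolding \<T>_def by blast
      moreover have "mono_on_set c i K"
        unfolding mono_on_set_def
      proof (intro allI impI, elim conjE)
        fix e assume e: "e \<subseteq> K" "card e = 2"
        then obtain x y where [simp]: "e = {x, y}" and "x \<noteq> y" by (auto simp: card_2_iff)
        then show "c e = i" using dxy[of x y] zero[of x y] e(1) unfolding d2 by auto
      qed
      ultimately show False using nc[of K i] i False by auto
    qed
  qed
  moreover have "\<forall>e. d e < Suc j + 2" using c unfolding d_def by (auto simp: less_Suc_eq)
  ultimately show ?case by blast
qed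

text \<open>With \<open>\<S>\<close> consisting of all sets of size \<open>2 * h + 2\<close>,
  comparing exponents of 2 and cancelling \<open>h + 1\<close> leaves the assumption with an extra 2
  on the right, which provides the strict inequality.\<close>

lemma ramsey_lower:
  assumes e: "4 * e + 4 * j \<le> 4 * h + 3 * h * j"
  shows "\<exists>c :: nat set \<Rightarrow> nat. (\<forall>e. c e < j + 2) \<and>
    (\<forall>K\<subseteq>{..<2 ^ e}. card K = 2 * h + 2 \<longrightarrow> (\<forall>i<j + 2. \<not> mono_on_set c i K))"
proof -
  let ?m = "2 * h + 2"
  let ?S = "{K. K \<subseteq> {..<2 ^ e :: nat} \<and> card K = ?m}"
  let ?T = "\<Sum>{..h}"
  \<comment> \<open>The factorial absorbs the factor 2 of the union bound.\<close>
  have "2 * card ?S \<le> card ?S * fact ?m"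
    using fact_ge_self[of ?m] by (simp add: mult.commute le_trans[of 2 ?m])
  also have "card ?S * fact ?m = ((2 ^ e) choose ?m) * fact ?m" by (simp add: n_subsets)
  also have "\<dots> \<le> (2 ^ e) ^ ?m" by (rule binomial_fact_pow)
  finally have S: "2 * card ?S \<le> 2 ^ (e * ?m)" by (simp only: power_mult)
  have T: "2 * ?T = h * (h + 1)" by (induction h) auto
  have ch: "?m choose 2 = (h + 1) * (2 * h + 1)" by (simp add: choose_two algebra_simps)
  have "(h + 1) * (4 * e + 4 * j) \<le> (h + 1) * (4 * h + 3 * h * j)" by (rule mult_le_mono2[OF e])
  moreover have "2 * (j * ?T) = j * (h * (h + 1))" using T by (metis mult.left_commute)
  ultimately have "e * ?m + j * (?m + ?m * h + ?T) < (?m choose 2) + j * (2 * h * ?m)"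
    unfolding ch by (simp add: algebra_simps)
  then have "(2 :: nat) ^ (e * ?m + j * (?m + ?m * h + ?T)) < 2 ^ ((?m choose 2) + j * (2 * h * ?m))"
    by (rule power_strict_increasing) simp
  then have "2 ^ (e * ?m) * (2 ^ (?m + ?m * h + ?T)) ^ j < 2 ^ (?m choose 2) * (2 ^ (2 * h * ?m) :: nat) ^ j"
    by (simp only: power_add[of _ "e * ?m"] power_add[of _ "?m choose 2"] mult.commute[of j] power_mult)
  moreover have "2 * card ?S * (2 ^ (?m + ?m * h + ?T)) ^ j \<le> 2 ^ (e * ?m) * (2 ^ (?m + ?m * h + ?T)) ^ j"
    using S by (rule mult_le_mono1)
  ultimately have "2 * card ?S * (2 ^ (?m + ?m * h + ?T)) ^ j < 2 ^ (?m choose 2) * (2 ^ (2 * h * ?m)) ^ j"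
    by (rule le_less_trans[rotated])
  then obtain c where "\<forall>e. c e < j + 2" "\<forall>K\<in>?S. \<forall>i<j + 2. \<not> mono_on_set c i K"
    using colouring_avoiding_family[OF finite_lessThan, of ?S "2 ^ e" h j] by blast
  then show ?thesis by (intro exI[of _ c]) simp
qed

section \<open>Deleting a vertex\<close>

lemma ramsey_arrowsI:
  assumes "\<And>c. (\<And>e. e \<subseteq> {..<N} \<Longrightarrow> card e = 2 \<Longrightarrow> c e < q) \<Longrightarrow>
    \<exists>f. \<exists>i<q. inj_on f V \<and> f ` V \<subseteq> {..<N} \<and> (\<forall>e\<in>E. c (f ` e) = i)"
  shows "ramsey_arrows q N V E"
  unfolding ramsey_arrows_def
proof (intro allI impI)
  fix c :: "nat set \<Rightarrow> nat"
  assume "\<forall>e. e \<subseteq> {..<N} \<and> card e = 2 \<longrightarrow> c e < q"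
  then show "\<exists>f. \<exists>i<q. inj_on f V \<and> f ` V \<subseteq> {..<N} \<and> (\<forall>e\<in>E. c (f ` e) = i)"
    by (intro assms) simp
qed

lemma ramsey_arrowsE:
  assumes "ramsey_arrows q N V E" "\<And>e. e \<subseteq> {..<N} \<Longrightarrow> card e = 2 \<Longrightarrow> c e < q"
  obtains f i where "i < q" "inj_on f V" "f ` V \<subseteq> {..<N}" "\<forall>e\<in>E. c (f ` e) = i"
proof -
  have "\<forall>e. e \<subseteq> {..<N} \<and> card e = 2 \<longrightarrow> c e < q" using assms(2) by simp
  from mp[OF spec[OF assms(1)[unfolded ramsey_arrows_def], of c] this]
  show thesis by (elim exE conjE) (rule that)
qed

lemma ramsey_arrows_mono:
  assumes "ramsey_arrows q N V E" "N \<le> M"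
  shows "ramsey_arrows q M V E"
proof (rule ramsey_arrowsI)
  fix c :: "nat set \<Rightarrow> nat"
  assume c: "\<And>e. e \<subseteq> {..<M} \<Longrightarrow> card e = 2 \<Longrightarrow> c e < q"
  have sub: "{..<N} \<subseteq> {..<M}" using assms(2) by simp
  have "c e < q" if "e \<subseteq> {..<N}" "card e = 2" for e using c subset_trans[OF that(1) sub] that(2) .
  with assms(1) obtain f i where "i < q" "inj_on f V" "f ` V \<subseteq> {..<N}" "\<forall>e\<in>E. c (f ` e) = i"
    by (rule ramsey_arrowsE)
  then show "\<exists>f. \<exists>i<q. inj_on f V \<and> f ` V \<subseteq> {..<M} \<and> (\<forall>e\<in>E. c (f ` e) = i)"
    using subset_trans[OF _ sub] by (intro exI[of _ f] exI[of _ i]) simp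
qed

text \<open>The first premise ensures that the minimum in \<open>ramsey_num\<close> is
  attained.\<close>

lemma less_ramsey_num:
  assumes "ramsey_arrows q M V E" "\<not> ramsey_arrows q N V E"
  shows "N < ramsey_num q V E"
  using assms ramsey_arrows_mono LeastI[of "\<lambda>N. ramsey_arrows q N V E" M]
  unfolding ramsey_num_def by (meson not_le)

lemma exists_ramsey_arrows:
  assumes q: "q \<ge> 2" and V: "simple_graph V E"
  shows "\<exists>M. ramsey_arrows q M V E"
proof (intro exI)
  let ?M = "q ^ (q * card V)"
  show "ramsey_arrows q ?M V E"
  proof (rule ramsey_arrowsI)
    fix c :: "nat set \<Rightarrow> nat" assume c: "\<And>e. e \<subseteq> {..<?M} \<Longrightarrow> card e = 2 \<Longrightarrow> c e < q"
    then obtain i K where iK: "i < q" "K \<subseteq> {..<?M}" "card K = card V" "mono_on_set c i K"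
      using ramsey_upper[OF q, of "{..<?M}" "\<lambda>_. card V" c] by auto
    have "finite V" "finite K"
      using V finite_subset[OF iK(2)] unfolding simple_graph_def by simp_all
    then obtain f where f: "bij_betw f V K" using finite_same_card_bij iK(3) by metis
    have inj: "inj_on f V" and im: "f ` V = K" using f unfolding bij_betw_def by auto
    have "c (f ` e) = i" if "e \<in> E" for e
    proof -
      have e: "e \<subseteq> V" "card e = 2" using V that unfolding simple_graph_def by auto
      then have "card (f ` e) = 2" using inj by (metis card_image inj_on_subset)
      then show ?thesis using iK(4) e(1) im unfolding mono_on_set_def by blast
    qed
    then show "\<exists>f. \<exists>i<q. inj_on f V \<and> f ` V \<subseteq> {..<?M} \<and> (\<forall>e\<in>E. c (f ` e) = i)"
      using iK inj im by blast
  qed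
qed

text \<open>A monochromatic clique on \<open>k\<close> of the \<open>n\<close> points exists, and
  the isolated vertices fill the other points; fewer than \<open>n\<close> points cannot hold
  \<open>n\<close> vertices.\<close>

lemma ramsey_num_clique_with_isolated_vertices:
  assumes q: "q \<ge> 2" and n: "q ^ (q * k) \<le> n" and kn: "k \<le> n"
  shows "ramsey_num q {..<n} {e. e \<subseteq> {..<k} \<and> card e = 2} = n" (is "ramsey_num q _ ?E = n")
  unfolding ramsey_num_def
proof (rule Least_equality)
  show "ramsey_arrows q n {..<n} ?E"
  proof (rule ramsey_arrowsI)
    fix c :: "nat set \<Rightarrow> nat" assume c: "\<And>e. e \<subseteq> {..<n} \<Longrightarrow> card e = 2 \<Longrightarrow> c e < q"
    then obtain i K where iK: "i < q" "K \<subseteq> {..<n}" "card K = k" "mono_on_set c i K"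
      using ramsey_upper[OF q, of "{..<n}" "\<lambda>_. k" c] n by auto
    have finK: "finite K" using iK(2) finite_subset by auto
    obtain f where f: "bij_betw f {..<k} K"
      using finite_same_card_bij[of "{..<k}" K] iK finK by auto
    \<comment> \<open>The isolated vertices are matched with the points outside the clique.\<close>
    have "card ({..<n} - {..<k}) = card ({..<n} - K)"
      using iK kn finK by (simp add: card_Diff_subset)
    then obtain g where g: "bij_betw g ({..<n} - {..<k}) ({..<n} - K)"
      using finite_same_card_bij[of "{..<n} - {..<k}" "{..<n} - K"] by auto
    let ?f = "\<lambda>x. if x < k then f x else g x"
    have "bij_betw ?f {..<k} K" using f by (rule bij_betw_cong[THEN iffD1, rotated]) auto
    moreover have "bij_betw ?f ({..<n} - {..<k}) ({..<n} - K)"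
      using g by (rule bij_betw_cong[THEN iffD1, rotated]) auto
    ultimately have bij: "bij_betw ?f ({..<k} \<union> ({..<n} - {..<k})) (K \<union> ({..<n} - K))"
      by (rule bij_betw_combine) auto
    have "{..<k} \<union> ({..<n} - {..<k}) = {..<n}" "K \<union> ({..<n} - K) = {..<n}" using kn iK(2) by auto
    then have "inj_on ?f {..<n}" "?f ` {..<n} = {..<n}"
      using bij unfolding bij_betw_def by simp_all
    moreover have "c (?f ` e) = i" if e: "e \<subseteq> {..<k}" "card e = 2" for e
    proof -
      have fe: "?f ` e = f ` e" using e by (intro image_cong) auto
      have "card (f ` e) = 2"
        using f e unfolding bij_betw_def by (metis card_image inj_on_subset)
      then show ?thesis using iK(4) e(1) f unfolding fe mono_on_set_def bij_betw_def by blast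
    qed
    ultimately show "\<exists>f. \<exists>i<q. inj_on f {..<n} \<and> f ` {..<n} \<subseteq> {..<n} \<and> (\<forall>e\<in>?E. c (f ` e) = i)"
      using iK(1) by (intro exI[of _ ?f] exI[of _ i]) auto
  qed
next
  fix N assume "ramsey_arrows q N {..<n} ?E"
  then obtain f where "inj_on f {..<n}" "f ` {..<n} \<subseteq> {..<N}"
    by (rule ramsey_arrowsE[where c = "\<lambda>_. 0"]) (use q in auto)
  then have "card {..<n} \<le> card {..<N}" by (intro card_inj_on_le) auto
  then show "n \<le> N" by simp
qed

text \<open>In colour \<open>p\<close> the star at \<open>n\<close> confines all
  \<open>n + 1\<close> vertices to one block of \<open>n\<close> points. In any other colour the
  \<open>k + 1\<close> clique vertices lie in distinct blocks and give a forbidden clique of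
  \<open>c0\<close>.\<close>

lemma not_ramsey_arrows_blowup:
  fixes c0 :: "nat set \<Rightarrow> nat"
  assumes n: "k < n" and c0: "\<And>e. c0 e < p"
    and nc: "\<And>K i. K \<subseteq> {..<M} \<Longrightarrow> card K = k + 1 \<Longrightarrow> i < p \<Longrightarrow> \<not> mono_on_set c0 i K"
  shows "\<not> ramsey_arrows (Suc p) (n * M) {..n} {e. e \<subseteq> {..n} \<and> card e = 2 \<and> (e \<subseteq> {..<k} \<or> n \<in> e)}"
    (is "\<not> ramsey_arrows _ _ _ ?E")
proof
  let ?b = "\<lambda>x. x div n"
  define c where "c e = (if \<exists>b. \<forall>x\<in>e. ?b x = b then p else c0 (?b ` e))" for e
  define E where "E = ?E"
  assume "ramsey_arrows (Suc p) (n * M) {..n} ?E"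
  then have "ramsey_arrows (Suc p) (n * M) {..n} E" unfolding E_def .
  moreover have "c e < Suc p" for e unfolding c_def using c0[THEN less_SucI] by auto
  ultimately obtain f i where i: "i < Suc p" and f: "inj_on f {..n}" "f ` {..n} \<subseteq> {..<n * M}"
    and mono: "\<forall>e\<in>E. c (f ` e) = i"
    by (rule ramsey_arrowsE)
  have cxy: "c {f x, f y} = i" if "x \<le> n" "y \<le> n" "x \<noteq> y" "x < k \<or> x = n" "y < k \<or> x = n \<or> y = n" for x y
    using bspec[OF mono, of "{x, y}"] that unfolding E_def by auto
  have c2: "c {x, y} = (if ?b x = ?b y then p else c0 {?b x, ?b y})" for x y
    unfolding c_def by auto
  show False
  proof (cases "i = p")
    case True
    have "?b (f x) = ?b (f n)" if "x \<le> n" for x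
    proof (cases "x = n")
      case False
      then show ?thesis
        using cxy[of n x] that c0[of "{?b (f n), ?b (f x)}"] unfolding c2 True
        by (auto split: if_splits)
    qed simp
    then have "f x \<in> {?b (f n) * n..<?b (f n) * n + n}" if "x \<le> n" for x
      using that n by (metis add.commute atLeastLessThan_iff div_times_less_eq_dividend
        dividend_less_div_times gr_implies_not0 mult.commute neq0_conv)
    then have "f ` {..n} \<subseteq> {?b (f n) * n..<?b (f n) * n + n}" by auto
    then have "card {..n} \<le> card {?b (f n) * n..<?b (f n) * n + n}"
      using f(1) by (intro card_inj_on_le) auto
    then show False by simp
  next
    case False
    let ?W = "insert n {..<k}" and ?g = "\<lambda>x. ?b (f x)"
    have g: "?g x \<noteq> ?g y \<and> c0 {?g x, ?g y} = i" if "x \<in> ?W" "y \<in> ?W" "x \<noteq> y" for x y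
      using cxy[of x y] that n False unfolding c2 by (auto split: if_splits)
    have inj: "inj_on ?g ?W" by (rule inj_onI) (use g in blast)
    have "?g ` ?W \<subseteq> {..<M}"
    proof (rule image_subsetI)
      fix x assume "x \<in> ?W"
      then have "x \<in> {..n}" using n by auto
      then have "f x < M * n" using f(2) by (auto simp: mult.commute)
      then show "?g x \<in> {..<M}" by (simp add: less_mult_imp_div_less)
    qed
    moreover have "card (?g ` ?W) = k + 1" using inj n by (simp add: card_image)
    moreover have "mono_on_set c0 i (?g ` ?W)"
      unfolding mono_on_set_def
    proof (intro allI impI, elim conjE)
      fix e assume e: "e \<subseteq> ?g ` ?W" "card e = 2"
      then obtain u v where uv: "e = {u, v}" "u \<noteq> v" by (auto simp: card_2_iff)
      then obtain x y where "x \<in> ?W" "y \<in> ?W" "u = ?g x" "v = ?g y" using e(1) by auto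
      then show "c0 e = i" using g uv by blast
    qed
    ultimately show False using nc i False by (metis less_antisym)
  qed
qed

section \<open>Assembling the graph and choosing the parameters\<close>

lemma exists_graph:
  fixes q n k h e :: nat
  assumes q: "q \<ge> 3" and n: "q ^ (q * k) \<le> n" and hk: "2 * h + 2 \<le> k + 1"
    and e: "4 * e + 4 * (q - 3) \<le> 4 * h + 3 * h * (q - 3)"
  shows "\<exists>(V :: nat set) E v. simple_graph V E \<and> card V = n + 1 \<and> v \<in> V \<and>
    n * 2 ^ e < ramsey_num q V E \<and> ramsey_num q (V - {v}) (del_vertex_edges E v) = n"
proof -
  let ?E = "{e. e \<subseteq> {..n} \<and> card e = 2 \<and> (e \<subseteq> {..<k} \<or> n \<in> e)}"
  \<comment> \<open>The clique must leave room for isolated vertices: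
    \<open>k < 2 ^ k \<le> q ^ (q * k) \<le> n\<close>.\<close>
  have "k < 2 ^ k" by simp
  also have "(2 :: nat) ^ k \<le> q ^ k" using q by (intro power_mono) auto
  also have "q ^ k \<le> q ^ (q * k)" using q by (intro power_increasing) auto
  finally have kn: "k < n" using n by simp
  have G: "simple_graph {..n} ?E" unfolding simple_graph_def by auto
  have q3: "q - 3 + 2 = q - 1" using q by simp
  obtain c :: "nat set \<Rightarrow> nat" where c: "\<forall>e. c e < q - 1" and
    nc: "\<forall>K\<subseteq>{..<2 ^ e}. card K = 2 * h + 2 \<longrightarrow> (\<forall>i<q - 1. \<not> mono_on_set c i K)"
    using ramsey_lower[OF e, unfolded q3] by (elim exE conjE)
  have "\<not> mono_on_set c i K" if K: "K \<subseteq> {..<2 ^ e}" "card K = k + 1" "i < q - 1" for K i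
  proof -
    have "2 * h + 2 \<le> card K" using hk K(2) by simp
    then obtain L where L: "L \<subseteq> K" "card L = 2 * h + 2"
      by (rule obtain_subset_with_card_n)
    then have "\<not> mono_on_set c i L" using nc K(3) subset_trans[OF L(1) K(1)] by simp
    then show ?thesis using mono_on_set_subset L(1) by blast
  qed
  from not_ramsey_arrows_blowup[OF kn c[rule_format] this]
  have "\<not> ramsey_arrows q (n * 2 ^ e) {..n} ?E" using q by simp
  moreover obtain M where "ramsey_arrows q M {..n} ?E"
    using exists_ramsey_arrows[OF _ G, of q] q by auto
  ultimately have "n * 2 ^ e < ramsey_num q {..n} ?E" using less_ramsey_num by blast
  moreover have "{..n} - {n} = {..<n}" by auto
  moreover have "del_vertex_edges ?E n = {e. e \<subseteq> {..<k} \<and> card e = 2}"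
    unfolding del_vertex_edges_def using kn by auto
  ultimately show ?thesis
    using G ramsey_num_clique_with_isolated_vertices[OF _ n] q kn
    by (intro exI[of _ "{..n}"] exI[of _ ?E] exI[of _ n]) auto
qed

text \<open>Each of \<open>k\<close>, \<open>h\<close>, \<open>e\<close> is chosen as large as its
  constraint permits. Up to rounding, \<open>e\<close> is \<open>(3 * q - 5) * h / 4\<close>,
  \<open>h\<close> is \<open>k / 2\<close> and \<open>k\<close> is \<open>log q n / q\<close>,
  whence the factor 8; the total rounding loss is at most \<open>3 * q\<close>.\<close>

lemma exponent_bound:
  fixes q n :: nat
  assumes q: "q \<ge> 3" and n: "n \<ge> q ^ (5 * q)"
  obtains k h e where "q ^ (q * k) \<le> n" "2 * h + 2 \<le> k + 1"
    "4 * e + 4 * (q - 3) \<le> 4 * h + 3 * h * (q - 3)"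
    "real e \<ge> (3 * real q - 5) / (8 * real q * log 2 (real q)) * log 2 (real n) - (3 * real q)"
proof -
  define k where "k = nat \<lfloor>log q n / q\<rfloor>"
  define h where "h = (k - 1) div 2"
  define j where "j = q - 3"
  define e where "e = (4 * h + 3 * h * j - 4 * j) div 4"
  have n0: "n > 0" using n q by (metis gr0I le_zero_eq not_numeral_le_zero power_not_zero)
  have "5 * real q = log q (real (q ^ (5 * q)))" using q by (simp add: log_nat_power)
  also have "\<dots> \<le> log q n" using n n0 q by (intro log_mono) (auto simp del: of_nat_power)
  finally have L5: "log q n / q \<ge> 5" using q by (simp add: field_simps)
  have k5: "k \<ge> 5" using L5 unfolding k_def by (simp add: le_nat_floor le_nat_iff le_floor_iff)
  have kle: "real k \<le> log q n / q" using L5 unfolding k_def by (simp add: of_nat_floor)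
  have kge: "real k > log q n / q - 1" using L5 unfolding k_def by linarith
  have 1: "q ^ (q * k) \<le> n"
  proof -
    have "real (q * k) \<le> log q n" using kle q by (simp add: field_simps)
    then have "real q powr real (q * k) \<le> real n" using q n0 by (simp add: le_log_iff)
    also have "real q powr real (q * k) = real (q ^ (q * k))"
      using q by (subst powr_realpow) simp_all
    finally show ?thesis by (simp only: of_nat_le_iff)
  qed
  have 2: "2 * h + 2 \<le> k + 1" using k5 unfolding h_def by simp
  \<comment> \<open>This is the purpose of \<open>n \<ge> q ^ (5 * q)\<close>: it makes the
    subtraction of \<open>4 * j\<close> in \<open>e\<close> genuine.\<close>
  have h2: "h \<ge> 2" using k5 unfolding h_def by simp
  then have "4 * j \<le> 3 * h * j" by simp
  then have 4: "4 * e + 4 * j \<le> 4 * h + 3 * h * j" "4 * h + 3 * h * j < 4 * e + 4 * j + 4"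
    unfolding e_def by linarith+
  have "2 * h + 2 \<ge> k" unfolding h_def by linarith
  then have "real (4 + 3 * j) * real k \<le> real (4 + 3 * j) * real (2 * h + 2)"
    by (intro mult_left_mono) auto
  moreover have "real (4 * h + 3 * h * j) < real (4 * e + 4 * j + 4)" using 4(2) by (simp only: of_nat_less_iff)
  ultimately have "real (4 + 3 * j) * real k \<le> 8 * e + 14 * j + 16" by (simp add: algebra_simps)
  moreover have "real (4 + 3 * j) * (log q n / q - 1) \<le> real (4 + 3 * j) * real k"
    using kge by (intro mult_left_mono) auto
  moreover define X where "X = real (4 + 3 * j) * (log q n / q)"
  ultimately have "X \<le> 8 * e + 17 * j + 20" by (simp add: algebra_simps)
  moreover have "17 * real j + 20 \<le> 24 * real q" using q unfolding j_def by (simp add: of_nat_diff)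
  ultimately have "X / 8 - 3 * real q \<le> e" by simp
  moreover have "X / 8 = (3 * real q - 5) / (8 * real q * log 2 (real q)) * log 2 (real n)"
  proof -
    have "real (4 + 3 * j) = 3 * real q - 5" using q unfolding j_def by (simp add: of_nat_diff)
    moreover have "log q n = log 2 n / log 2 q" using q n0 by (simp add: log_def)
    ultimately show ?thesis unfolding X_def by (simp only: times_divide_eq_left times_divide_eq_right divide_divide_eq_left ac_simps)
  qed
  ultimately show thesis using that[OF 1 2 4(1)[unfolded j_def]] by simp
qed

theorem theorem5p1:
  fixes q :: nat
  assumes "q \<ge> 3"
  shows "\<exists>\<delta> :: nat \<Rightarrow> real. \<delta> \<longlonglongrightarrow> 0 \<and>
           (\<forall>\<^sub>F n in sequentially.
              \<exists>(V :: nat set) E v. simple_graph V E \<and> card V = n + 1 \<and> v \<in> V \<and>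
                real (ramsey_num q V E) >
                  real n powr (1 + (3 * real q - 5) / (8 * real q * log 2 (real q)) - \<delta> n) \<and>
                ramsey_num q (V - {v}) (del_vertex_edges E v) = n) \<and>
           (\<exists>\<alpha> > (0::real). \<forall>\<^sub>F n in sequentially.
              \<exists>(V :: nat set) E v. simple_graph V E \<and> card V = n + 1 \<and> v \<in> V \<and>
                real (ramsey_num q V E) >
                  real n powr (1 + (3 * real q - 5) / (8 * real q * log 2 (real q)) - \<delta> n) \<and>
                ramsey_num q (V - {v}) (del_vertex_edges E v) = n \<and>
                real (ramsey_num q V E) \<ge>
                  real (ramsey_num q (V - {v}) (del_vertex_edges E v)) powr (1 + \<alpha>))"
proof -
  define \<gamma> where "\<gamma> = (3 * real q - 5) / (8 * real q * log 2 (real q))"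
  \<comment> \<open>With this choice \<open>n\<close> to the power \<open>- \<delta> n\<close> is
    the constant \<open>2 powr (- 3 * q)\<close>, exactly the rounding loss.\<close>
  define \<delta> where "\<delta> n = 3 * real q / log 2 (real n)" for n :: nat
  have \<gamma>: "\<gamma> > 0" unfolding \<gamma>_def using assms by (intro divide_pos_pos mult_pos_pos) auto
  have "(\<lambda>n. 3 * real q * ln 2 / ln (real n)) \<longlonglongrightarrow> 0"
    by (intro tendsto_divide_0[OF tendsto_const] filterlim_at_top_imp_at_infinity
        filterlim_compose[OF ln_at_top filterlim_real_sequentially])
  then have lim: "\<delta> \<longlonglongrightarrow> 0" unfolding \<delta>_def log_def by simp
  let ?G = "\<lambda>n (V :: nat set) E v. simple_graph V E \<and> card V = n + 1 \<and> v \<in> V \<and>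
    real (ramsey_num q V E) > real n powr (1 + \<gamma> - \<delta> n) \<and>
    ramsey_num q (V - {v}) (del_vertex_edges E v) = n"
  have ex: "\<exists>V E v. ?G n V E v" if n: "n \<ge> q ^ (5 * q)" for n
  proof -
    obtain k h e where khe: "q ^ (q * k) \<le> n" "2 * h + 2 \<le> k + 1"
      "4 * e + 4 * (q - 3) \<le> 4 * h + 3 * h * (q - 3)" "real e \<ge> \<gamma> * log 2 (real n) - 3 * real q"
      using exponent_bound[OF assms n] unfolding \<gamma>_def by metis
    obtain V :: "nat set" and E v where G: "simple_graph V E" "card V = n + 1" "v \<in> V"
      "n * 2 ^ e < ramsey_num q V E" "ramsey_num q (V - {v}) (del_vertex_edges E v) = n"
      using exists_graph[OF assms khe(1-3)] by blast
    have "q ^ 1 \<le> q ^ (5 * q)" using assms by (intro power_increasing) auto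
    then have n3: "n \<ge> 3" using assms n by simp
    then have "log 2 (real n) > 0" by simp
    then have "\<gamma> * log 2 (real n) - 3 * real q = log 2 (real n) * (\<gamma> - \<delta> n)"
      unfolding \<delta>_def by (simp add: field_simps)
    then have "real n powr (\<gamma> - \<delta> n) = 2 powr (\<gamma> * log 2 (real n) - 3 * real q)"
      using n3 by (simp flip: powr_powr)
    also have "\<dots> \<le> 2 powr real e" using khe(4) by simp
    also have "\<dots> = 2 ^ e" by (simp add: powr_realpow)
    finally have "real n * real n powr (\<gamma> - \<delta> n) \<le> real n * 2 ^ e" by (simp add: mult_left_mono)
    also have "real n * real n powr (\<gamma> - \<delta> n) = real n powr (1 + \<gamma> - \<delta> n)"
      using n3 by (simp add: powr_add powr_diff)
    also have "real n * 2 ^ e = real (n * 2 ^ e)" by simp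
    also have "\<dots> < real (ramsey_num q V E)" using G(4) by (simp only: of_nat_less_iff)
    finally show ?thesis using G by blast
  qed
  have ev: "\<forall>\<^sub>F n in sequentially. \<exists>V E v. ?G n V E v"
    using ex by (rule eventually_sequentiallyI)
  \<comment> \<open>Eventually \<open>\<delta> n < \<gamma> / 2\<close>, so half of the gain
    \<open>\<gamma>\<close> serves as \<alpha>.\<close>
  have "\<forall>\<^sub>F n in sequentially. \<exists>V E v. ?G n V E v \<and>
      real (ramsey_num q V E) \<ge> real (ramsey_num q (V - {v}) (del_vertex_edges E v)) powr (1 + \<gamma> / 2)"
    using ev order_tendstoD(2)[OF lim half_gt_zero[OF \<gamma>]] eventually_ge_at_top[of 1]
  proof eventually_elim
    case (elim n)
    then obtain V E v where G: "?G n V E v" using \<gamma> by auto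
    have "real n powr (1 + \<gamma> / 2) \<le> real n powr (1 + \<gamma> - \<delta> n)"
      using elim \<gamma> by (intro powr_mono) auto
    then show ?case using G by (intro exI[of _ V] exI[of _ E] exI[of _ v]) auto
  qed
  then have "\<exists>\<alpha>>0. \<forall>\<^sub>F n in sequentially. \<exists>(V :: nat set) E v. simple_graph V E \<and> card V = n + 1 \<and> v \<in> V \<and>
    real (ramsey_num q V E) > real n powr (1 + \<gamma> - \<delta> n) \<and>
    ramsey_num q (V - {v}) (del_vertex_edges E v) = n \<and>
    real (ramsey_num q V E) \<ge> real (ramsey_num q (V - {v}) (del_vertex_edges E v)) powr (1 + \<alpha>)"
    using \<gamma> by (intro exI[of _ "\<gamma> / 2"]) auto
  then show ?thesis using lim ev unfolding \<gamma>_def by blast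
qed

end
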